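(* Let $n\ge2$, $n'=\frac n{n-1}$, and let $\Omega\subset\mathbb{R}^n$ be a bounded open set with $|\Omega|=1$. (1) Let $1\ge\alpha>\frac1{n'}$. Then there is a constant $c>0$ such that for all $v\in L^{(n'}(\Omega)$, $$\|v\|_{L^{n',\infty}}\le c\,\|v\|_{L^{n')}}^{1-\alpha}\,\|v\|_{L^{(n'}}^{\alpha}.$$ (2) For any $\alpha\in(0,1)$ there is a constant $c>0$ such that for all $v\in L^{(n'}(\Omega)$, $$\|v\|_{(L^{n',\infty},L^{(n'})_{\alpha,1}}\le c\,\|v\|_{L^{n'}}^{1-\alpha}\,\|v\|_{L^{(n'}}^{\alpha}.$$
   Context: $\log$ is the natural logarithm. For measurable $f:\Omega\to\mathbb{R}$, $f_*$ is the decreasing rearrangement of $|f|$ on $(0,1)$: $f_*(s)=\inf\{t\ge0:|\{x:|f(x)|>t\}|\le s\}$, and $f_*^p=(f_* )^p$. For $1<p<\infty$: $\|f\|_{L^{p,\infty}}=\sup_{0<s<1}s^{1/p}f_*(s)$; small Lebesgue space: $\|f\|_{L^{(p}}=\int_0^1(1-\log t)^{-1/p}\left(\int_0^t f_*^p(\sigma)\,d\sigma\right)^{1/p}\frac{dt}{t}$; grand Lebesgue space: $\|f\|_{L^{p)}}=\sup_{0<t<1}(1-\log t)^{-1/p}\left(\int_t^1 f_*^p(\sigma)\,d\sigma\right)^{1/p}$. For a compatible couple $(X_0,X_1)$, $K(f,t;X_0,X_1)=\inf_{f=f_0+f_1}(\|f_0\|_{X_0}+t\|f_1\|_{X_1})$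 and $\|f\|_{(X_0,X_1)_{\alpha,1}}=\int_0^1t^{-\alpha}K(f,t;X_0,X_1)\frac{dt}{t}$. *)

theory Defs
  imports "HOL-Analysis.Analysis"
begin

(* Real powers on [0,\<infinity>], intended for exponents a \<ge> 0; unlike powr on the reals, x^0 = 1 also
   for x = 0. *)
definition epowr :: "ennreal \<Rightarrow> real \<Rightarrow> ennreal" where
  "epowr x a = (if a = 0 then 1 else if x = \<infinity> then \<infinity> else ennreal (enn2real x powr a))"

definition conj_exponent :: "nat \<Rightarrow> real" where
  "conj_exponent n = real n / (real n - 1)"

(* All (quasi-)norms below take values in [0,\<infinity>]; membership in the corresponding space means
   measurability together with a finite value, see fun_space. *)

definition decr_rearr :: "'a measure \<Rightarrow> ('a \<Rightarrow> real) \<Rightarrow> real \<Rightarrow> ennreal" where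
  "decr_rearr M f s =
     Inf {ennreal t | t. 0 \<le> t \<and> emeasure M {x \<in> space M. \<bar>f x\<bar> > t} \<le> ennreal s}"

definition Lp_norm :: "'a measure \<Rightarrow> real \<Rightarrow> ('a \<Rightarrow> real) \<Rightarrow> ennreal" where
  "Lp_norm M p f = epowr (\<integral>\<^sup>+ x. ennreal (\<bar>f x\<bar> powr p) \<partial>M) (1 / p)"

definition weak_Lp_norm :: "'a measure \<Rightarrow> real \<Rightarrow> ('a \<Rightarrow> real) \<Rightarrow> ennreal" where
  "weak_Lp_norm M p f = (SUP s\<in>{0<..<1}. ennreal (s powr (1 / p)) * decr_rearr M f s)"

definition small_Lp_norm :: "'a measure \<Rightarrow> real \<Rightarrow> ('a \<Rightarrow> real) \<Rightarrow> ennreal" where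
  "small_Lp_norm M p f =
     (\<integral>\<^sup>+ t\<in>{0<..<1}. ennreal ((1 - ln t) powr (- 1 / p) / t) *
        epowr (\<integral>\<^sup>+ \<sigma>\<in>{0<..<t}. epowr (decr_rearr M f \<sigma>) p \<partial>lborel) (1 / p) \<partial>lborel)"

definition grand_Lp_norm :: "'a measure \<Rightarrow> real \<Rightarrow> ('a \<Rightarrow> real) \<Rightarrow> ennreal" where
  "grand_Lp_norm M p f =
     (SUP t\<in>{0<..<1}. ennreal ((1 - ln t) powr (- 1 / p)) *
        epowr (\<integral>\<^sup>+ \<sigma>\<in>{t<..<1}. epowr (decr_rearr M f \<sigma>) p \<partial>lborel) (1 / p))"

definition fun_space :: "'a measure \<Rightarrow> (('a \<Rightarrow> real) \<Rightarrow> ennreal) \<Rightarrow> ('a \<Rightarrow> real) set" where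
  "fun_space M N = {f \<in> borel_measurable M. N f < \<infinity>}"

(* The decomposition is required almost everywhere, since elements of the spaces are classes of
   a.e. equal functions. The infimum over the empty set is \<infinity>. *)
definition K_functional ::
  "'a measure \<Rightarrow> (('a \<Rightarrow> real) \<Rightarrow> ennreal) \<Rightarrow> (('a \<Rightarrow> real) \<Rightarrow> ennreal) \<Rightarrow> ('a \<Rightarrow> real) \<Rightarrow> real \<Rightarrow> ennreal"
  where
  "K_functional M N0 N1 f t =
     Inf {N0 f0 + ennreal t * N1 f1 | f0 f1.
            f0 \<in> fun_space M N0 \<and> f1 \<in> fun_space M N1 \<and> (AE x in M. f x = f0 x + f1 x)}"

definition interp_norm ::
  "'a measure \<Rightarrow> (('a \<Rightarrow> real) \<Rightarrow> ennreal) \<Rightarrow> (('a \<Rightarrow> real) \<Rightarrow> ennreal) \<Rightarrow> real \<Rightarrow> ('a \<Rightarrow> real) \<Rightarrow> ennreal"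
  where
  "interp_norm M N0 N1 \<alpha> f =
     (\<integral>\<^sup>+ t\<in>{0<..<1}. ennreal (t powr (- \<alpha>) / t) * K_functional M N0 N1 f t \<partial>lborel)"

end

theory Submission
  imports Defs
begin

text \<open>
  Write \<open>g\<close> for the decreasing rearrangement of \<open>v\<close>, \<open>p\<close> for the conjugate exponent,
  \<open>x = s\<^sup>1\<^sup>/\<^sup>p g(s)\<close> and \<open>L = 1 - ln s \<ge> 1\<close>. Since \<open>g\<close> decreases, its values to the left of
  \<open>s\<close> are at least \<open>g(s)\<close>, so each integral of \<open>g\<^sup>p\<close> in the grand and the small norm is
  bounded below by \<open>g(s)\<^sup>p\<close> times the length of a suitable subinterval. Restricting the
  variable \<open>t\<close> of these norms to \<open>t = s/e\<close> and to \<open>t > s/e\<close>, respectively, this gives, with \<open>k = (2 e)\<^sup>1\<^sup>/\<^sup>p\<close>,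

  \<^item> \<open>x \<le> k L\<^sup>1\<^sup>/\<^sup>p G\<close> for the grand norm \<open>G\<close> (\<open>rearr_le_grand_Lp_norm\<close>), and
  \<^item> \<open>x \<le> k L\<^sup>1\<^sup>/\<^sup>p\<^sup>-\<^sup>1 S\<close> for the small norm \<open>S\<close> (\<open>rearr_le_small_Lp_norm\<close>).

  The geometric mean of the two bounds with weights \<open>1 - \<alpha>\<close> and \<open>\<alpha>\<close> carries the factor
  \<open>L\<close> to the power \<open>1/p - \<alpha>\<close>, which is at most 1 as soon as \<open>\<alpha> \<ge> 1/p\<close>. A supremum over
  \<open>s\<close> gives the first part (\<open>weak_Lp_norm_le_grand_small\<close>).

  Taking \<open>\<alpha> = 1\<close> there, the small space embeds into the weak one, so \<open>v = v + 0\<close> and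
  \<open>v = 0 + v\<close> are both admissible in the \<open>K\<close>-functional, whence \<open>K(v,t)\<close> is at most
  the minimum of the weak norm of \<open>v\<close> and \<open>t S\<close>. Chebyshev's inequality bounds the weak norm
  by the \<open>L\<^sup>p\<close> norm \<open>P\<close> (\<open>weak_Lp_norm_le_Lp_norm\<close>). Integrating the minimum of \<open>P\<close> and
  \<open>t S\<close> against the weight, with the cut at \<open>t = P/S\<close>, produces \<open>P\<close> to the power
  \<open>1 - \<alpha>\<close> times \<open>S\<close> to the power \<open>\<alpha>\<close> up to a constant
  (\<open>interp_norm_le_of_embedding\<close>), which is the second part.
\<close>

section \<open>Powers in the extended half-line\<close>

lemma epowr_ennreal: "0 \<le> x \<Longrightarrow> 0 < a \<Longrightarrow> epowr (ennreal x) a = ennreal (x powr a)"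
  by (simp add: epowr_def)

lemma epowr_zero_right [simp]: "epowr x 0 = 1"
  by (simp add: epowr_def)

lemma epowr_zero_left [simp]: "0 < a \<Longrightarrow> epowr 0 a = 0"
  by (simp add: epowr_def)

lemma epowr_top [simp]: "0 < a \<Longrightarrow> epowr top a = top"
  by (simp add: epowr_def)

lemma epowr_one_right [simp]: "epowr x 1 = x"
  by (cases x) (simp_all add: epowr_def)

lemma epowr_eq_0_iff [simp]: "0 < a \<Longrightarrow> epowr x a = 0 \<longleftrightarrow> x = 0"
  by (cases x) (simp_all add: epowr_def ennreal_eq_0_iff)

lemma epowr_mono:
  assumes "x \<le> y" "0 < a"
  shows "epowr x a \<le> epowr y a"
proof (cases "y = \<infinity>")
  case False
  then have "x \<noteq> \<infinity>"
    using assms(1) by (auto simp: top_unique)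
  then show ?thesis
    using assms False
    by (auto simp: epowr_def top.not_eq_extremum intro!: ennreal_leI powr_mono2 enn2real_mono)
qed (use assms in simp)

lemma epowr_mult:
  assumes "0 < a"
  shows "epowr (x * y) a = epowr x a * epowr y a"
proof (cases "x = 0 \<or> y = 0")
  case False
  with assms show ?thesis
    by (cases x; cases y)
      (auto simp: epowr_ennreal powr_mult ennreal_eq_0_iff ennreal_mult_top ennreal_top_mult
        simp flip: ennreal_mult)
qed (use assms in auto)

lemma epowr_epowr_inverse:
  assumes "0 < p"
  shows "epowr (epowr x p) (1 / p) = x"
  using assms by (cases x) (auto simp: epowr_ennreal powr_powr)

section \<open>Averages of the rearrangement\<close>

lemma decr_rearr_antimono:
  assumes "s \<le> t"
  shows "decr_rearr M f t \<le> decr_rearr M f s"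
  unfolding decr_rearr_def
  using ennreal_leI[OF assms] by (intro Inf_superset_mono) (blast intro: order_trans)

text \<open>
  The source of every lower bound for the two norms: on \<open>(a, b)\<close>, to the left of \<open>s\<close>, the
  rearrangement is at least its value at \<open>s\<close>. The estimate holds for infinite values too.
\<close>
lemma epowr_nn_integral_rearr_ge:
  assumes "0 < p" "a \<le> b" "b \<le> s" "{a<..<b} \<subseteq> A"
  shows "decr_rearr M f s * ennreal ((b - a) powr (1 / p))
    \<le> epowr (\<integral>\<^sup>+ \<sigma>\<in>A. epowr (decr_rearr M f \<sigma>) p \<partial>lborel) (1 / p)"
proof -
  have "epowr (decr_rearr M f s) p * ennreal (b - a)
      = (\<integral>\<^sup>+ \<sigma>. epowr (decr_rearr M f s) p * indicator {a<..<b} \<sigma> \<partial>lborel)"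
    using assms by (simp add: nn_integral_cmult_indicator)
  also have "\<dots> \<le> (\<integral>\<^sup>+ \<sigma>\<in>A. epowr (decr_rearr M f \<sigma>) p \<partial>lborel)"
    using assms
    by (intro nn_integral_mono)
      (auto simp: indicator_def intro!: epowr_mono decr_rearr_antimono)
  finally have "epowr (epowr (decr_rearr M f s) p * ennreal (b - a)) (1 / p)
      \<le> epowr (\<integral>\<^sup>+ \<sigma>\<in>A. epowr (decr_rearr M f \<sigma>) p \<partial>lborel) (1 / p)"
    using assms by (intro epowr_mono) auto
  then show ?thesis
    using assms by (simp add: epowr_mult epowr_epowr_inverse epowr_ennreal)
qed

text \<open>
  On the interval \<open>(s/e, 1)\<close> the weight \<open>1 - ln t\<close> is at most \<open>2 (1 - ln s)\<close>, and the
  measure \<open>dt/t\<close> of this interval is exactly \<open>1 - ln s\<close>. Keeping only that part of the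
  outer integral loses no power of the logarithm.
\<close>
lemma rearr_le_small_Lp_norm:
  assumes p: "0 < p" and s: "0 < s" "s < 1"
  shows "ennreal (s powr (1 / p)) * decr_rearr M f s
    \<le> ennreal ((2 * exp 1) powr (1 / p) * (1 - ln s) powr (1 / p - 1)) * small_Lp_norm M p f"
proof -
  define L where "L = 1 - ln s"
  define r where "r = s / exp 1"
  define k where "k = (2 * L) powr (- 1 / p) * r powr (1 / p)"
  have L: "1 \<le> L"
    using s by (simp add: L_def)
  have r: "0 < r" "r \<le> s" "ln r = - L"
    using s by (auto simp: r_def L_def ln_div field_simps)
  then have "r < 1"
    using s by simp
  note r = r this
  have "((\<lambda>t. 1 / t) has_integral ln 1 - ln r) {r..1}"
    using r by (intro fundamental_theorem_of_calculus)
      (auto intro!: derivative_eq_intros simp flip: has_real_derivative_iff_has_vector_derivative)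
  then have int: "(\<integral>\<^sup>+ t\<in>{r<..<1}. ennreal (1 / t) \<partial>lborel) = ennreal L"
    using r by (intro nn_integral_has_integral_lebesgue') (auto simp: has_integral_Icc_iff_Ioo)
  have "ennreal k * decr_rearr M f s * ennreal L
      = (\<integral>\<^sup>+ t. ennreal k * decr_rearr M f s * (ennreal (1 / t) * indicator {r<..<1} t) \<partial>lborel)"
    by (subst nn_integral_cmult) (simp_all add: int)
  also have "\<dots> \<le> small_Lp_norm M p f"
    unfolding small_Lp_norm_def
  proof (rule nn_integral_mono)
    fix t :: real
    show "ennreal k * decr_rearr M f s * (ennreal (1 / t) * indicator {r<..<1} t)
      \<le> ennreal ((1 - ln t) powr (- 1 / p) / t) *
          epowr (\<integral>\<^sup>+ \<sigma>\<in>{0<..<t}. epowr (decr_rearr M f \<sigma>) p \<partial>lborel) (1 / p)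
          * indicator {0<..<1} t" (is "_ \<le> _ * ?I * _")
    proof (cases "t \<in> {r<..<1}")
      case True
      have "ln r \<le> ln t" "ln t \<le> 0"
        using True r(1) by (auto intro!: ln_mono)
      then have "(2 * L) powr (- 1 / p) \<le> (1 - ln t) powr (- 1 / p)"
        using L p r by (intro powr_mono2') auto
      then have "ennreal ((2 * L) powr (- 1 / p) / t) \<le> ennreal ((1 - ln t) powr (- 1 / p) / t)"
        using True r by (intro ennreal_leI divide_right_mono) auto
      moreover have "decr_rearr M f s * ennreal (r powr (1 / p)) \<le> ?I"
      proof -
        have "{0<..<r} \<subseteq> {0<..<t}"
          using True by (intro subsetI) simp
        then show ?thesis
          using epowr_nn_integral_rearr_ge[of p 0 r s "{0<..<t}" M f] p r(1,2) by simp
      qed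
      ultimately have "ennreal ((2 * L) powr (- 1 / p) / t) * (decr_rearr M f s * ennreal (r powr (1 / p)))
          \<le> ennreal ((1 - ln t) powr (- 1 / p) / t) * ?I"
        by (rule mult_mono) auto
      moreover have "ennreal k * ennreal (1 / t)
          = ennreal ((2 * L) powr (- 1 / p) / t) * ennreal (r powr (1 / p))"
        using True r by (simp add: k_def field_simps flip: ennreal_mult)
      ultimately show ?thesis
        using True r by (simp add: mult_ac) (metis mult.left_commute)
    qed simp
  qed
  finally have main: "ennreal k * decr_rearr M f s * ennreal L \<le> small_Lp_norm M p f" .
  have "s powr (1 / p) = (2 * exp 1) powr (1 / p) * L powr (1 / p - 1) * (k * L)"
    using L s by (simp add: k_def r_def powr_divide powr_mult powr_minus powr_diff field_simps)
  then have "ennreal (s powr (1 / p)) * decr_rearr M f s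
      = ennreal ((2 * exp 1) powr (1 / p) * L powr (1 / p - 1)) * (ennreal k * decr_rearr M f s * ennreal L)"
    using L by (simp add: ennreal_mult k_def mult_ac)
  also have "\<dots> \<le> ennreal ((2 * exp 1) powr (1 / p) * L powr (1 / p - 1)) * small_Lp_norm M p f"
    using main by (rule mult_left_mono) simp
  finally show ?thesis
    by (simp add: L_def)
qed

text \<open>
  The supremum is tested at \<open>t = s/e\<close>. The interval \<open>(s/e, s)\<close> has length at least
  \<open>s/e\<close> because \<open>e \<ge> 2\<close>, so the constant is the same as for the small norm and the
  two bounds can be combined without further adjustment.
\<close>
lemma rearr_le_grand_Lp_norm:
  assumes p: "0 < p" and s: "0 < s" "s < 1"
  shows "ennreal (s powr (1 / p)) * decr_rearr M f s
    \<le> ennreal ((2 * exp 1) powr (1 / p) * (1 - ln s) powr (1 / p)) * grand_Lp_norm M p f"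
proof -
  define L where "L = 1 - ln s"
  define r where "r = s / exp 1"
  have L: "1 \<le> L"
    using s by (simp add: L_def)
  have e: "2 \<le> exp (1::real)"
    using exp_ge_add_one_self[of 1] by simp
  have r: "0 < r" "r < 1" "ln r = - L"
    using s e by (auto simp: r_def L_def ln_div field_simps)
  have rs: "r \<le> s - r"
    using mult_left_mono[OF e, of s] s by (simp add: r_def field_simps)
  have "decr_rearr M f s * ennreal (r powr (1 / p))
      \<le> decr_rearr M f s * ennreal ((s - r) powr (1 / p))"
    using rs r p by (intro mult_left_mono ennreal_leI powr_mono2) auto
  also have "\<dots> \<le> epowr (\<integral>\<^sup>+ \<sigma>\<in>{r<..<1}. epowr (decr_rearr M f \<sigma>) p \<partial>lborel) (1 / p)"
    using p r rs s by (intro epowr_nn_integral_rearr_ge) auto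
  finally have "ennreal ((1 - ln r) powr (- 1 / p)) * (decr_rearr M f s * ennreal (r powr (1 / p)))
      \<le> ennreal ((1 - ln r) powr (- 1 / p)) *
          epowr (\<integral>\<^sup>+ \<sigma>\<in>{r<..<1}. epowr (decr_rearr M f \<sigma>) p \<partial>lborel) (1 / p)"
    by (rule mult_left_mono) simp
  also have "\<dots> \<le> grand_Lp_norm M p f"
    unfolding grand_Lp_norm_def using r by (intro SUP_upper) auto
  also have "1 - ln r = 1 + L"
    using r by simp
  finally have main: "ennreal ((1 + L) powr (- 1 / p)) * (decr_rearr M f s * ennreal (r powr (1 / p)))
      \<le> grand_Lp_norm M p f" .
  have "s powr (1 / p) = (exp 1 * (1 + L)) powr (1 / p) * ((1 + L) powr (- 1 / p) * r powr (1 / p))"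
    unfolding powr_mult[of "exp 1"] using L s by (simp add: r_def powr_divide powr_minus)
  also have "\<dots> \<le> (2 * exp 1 * L) powr (1 / p) * ((1 + L) powr (- 1 / p) * r powr (1 / p))"
    using L p by (intro mult_right_mono powr_mono2) (auto simp: field_simps)
  also have "(2 * exp 1 * L) powr (1 / p) = (2 * exp 1) powr (1 / p) * L powr (1 / p)"
    using L by (simp add: powr_mult)
  finally have "ennreal (s powr (1 / p)) * decr_rearr M f s
      \<le> ennreal ((2 * exp 1) powr (1 / p) * L powr (1 / p) * ((1 + L) powr (- 1 / p) * r powr (1 / p)))
          * decr_rearr M f s"
    by (intro mult_right_mono ennreal_leI) auto
  also have "\<dots> = ennreal ((2 * exp 1) powr (1 / p) * L powr (1 / p))
      * (ennreal ((1 + L) powr (- 1 / p)) * (decr_rearr M f s * ennreal (r powr (1 / p))))"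
    by (simp add: ennreal_mult mult_ac)
  also have "\<dots> \<le> ennreal ((2 * exp 1) powr (1 / p) * L powr (1 / p)) * grand_Lp_norm M p f"
    using main by (rule mult_left_mono) simp
  finally show ?thesis
    by (simp add: L_def)
qed

section \<open>The weak norm between the grand and the small norm\<close>

text \<open>
  Geometric mean of the two bounds: the powers of \<open>L\<close> combine to
  \<open>b (1 - \<alpha>) + (b - 1) \<alpha> = b - \<alpha> \<le> 0\<close>. The endpoint \<open>\<alpha> = 1\<close> is treated apart, since
  there the zeroth power of \<open>G\<close> is 1 even if \<open>G\<close> is 0 or infinite.
\<close>
lemma interpolate_log_bounds:
  fixes x G S :: ennreal and k L b \<alpha> :: real
  assumes k: "0 \<le> k" and L: "1 \<le> L" and b: "0 \<le> b" "b \<le> \<alpha>" "0 < \<alpha>" "\<alpha> \<le> 1"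
    and G: "x \<le> ennreal (k * L powr b) * G"
    and S: "x \<le> ennreal (k * L powr (b - 1)) * S"
  shows "x \<le> ennreal k * epowr G (1 - \<alpha>) * epowr S \<alpha>"
proof -
  let ?k = "k * L powr (b - \<alpha>)"
  have bound: "x \<le> ennreal ?k * epowr G (1 - \<alpha>) * epowr S \<alpha>"
  proof (cases "\<alpha> = 1")
    case False
    then have \<alpha>: "0 < 1 - \<alpha>"
      using b by simp
    have split: "y = epowr y (1 - \<alpha>) * epowr y \<alpha>" for y
      using \<alpha> b by (cases y)
        (auto simp: epowr_ennreal simp flip: ennreal_mult powr_add)
    have "x = epowr x (1 - \<alpha>) * epowr x \<alpha>"
      by (rule split)
    also have "\<dots> \<le> epowr (ennreal (k * L powr b) * G) (1 - \<alpha>) * epowr (ennreal (k * L powr (b - 1)) * S) \<alpha>"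
      using \<alpha> b by (intro mult_mono epowr_mono G S) auto
    also have "\<dots> = ennreal ((k * L powr b) powr (1 - \<alpha>) * (k * L powr (b - 1)) powr \<alpha>)
        * epowr G (1 - \<alpha>) * epowr S \<alpha>"
      using \<alpha> b k by (simp add: epowr_mult epowr_ennreal ennreal_mult powr_mult mult_ac)
    also have "(k * L powr b) powr (1 - \<alpha>) * (k * L powr (b - 1)) powr \<alpha>
        = (k powr (1 - \<alpha>) * k powr \<alpha>) * (L powr (b * (1 - \<alpha>)) * L powr ((b - 1) * \<alpha>))"
      using k L by (simp add: powr_mult powr_powr)
    also have "\<dots> = ?k"
      using k L by (simp add: algebra_simps flip: powr_add)
    finally show ?thesis .
  qed (use S in simp)
  have "ennreal ?k \<le> ennreal k"
    using k L b powr_mono[of "b - \<alpha>" 0 L] by (intro ennreal_leI) (simp add: mult_left_le)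
  then show ?thesis
    by (intro order_trans[OF bound] mult_right_mono) auto
qed

lemma weak_Lp_norm_le_grand_small:
  assumes "0 < p" "1 / p \<le> \<alpha>" "\<alpha> \<le> 1"
  shows "weak_Lp_norm M p f
    \<le> ennreal ((2 * exp 1) powr (1 / p)) * epowr (grand_Lp_norm M p f) (1 - \<alpha>)
        * epowr (small_Lp_norm M p f) \<alpha>"
  unfolding weak_Lp_norm_def
proof (rule SUP_least)
  fix s :: real
  assume s: "s \<in> {0<..<1}"
  have "0 < \<alpha>"
    using assms by (meson order_less_le_trans zero_less_divide_1_iff)
  then show "ennreal (s powr (1 / p)) * decr_rearr M f s
    \<le> ennreal ((2 * exp 1) powr (1 / p)) * epowr (grand_Lp_norm M p f) (1 - \<alpha>)
        * epowr (small_Lp_norm M p f) \<alpha>"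
    using s assms
    by (intro interpolate_log_bounds[where L = "1 - ln s" and b = "1 / p"]
        rearr_le_grand_Lp_norm rearr_le_small_Lp_norm) auto
qed

lemma weak_Lp_norm_le_small:
  assumes "1 \<le> p"
  shows "weak_Lp_norm M p f \<le> ennreal ((2 * exp 1) powr (1 / p)) * small_Lp_norm M p f"
  using weak_Lp_norm_le_grand_small[of p 1 M f] assms by simp

section \<open>The interpolation norm\<close>

text \<open>
  Chebyshev's inequality: with \<open>I\<close> the integral of \<open>\<bar>f\<bar>\<^sup>p\<close>, the superlevel set of
  \<open>\<bar>f\<bar>\<close> at height \<open>(I/s)\<^sup>1\<^sup>/\<^sup>p\<close> has measure at most \<open>s\<close>.
\<close>
lemma weak_Lp_norm_le_Lp_norm:
  assumes p: "0 < p" and f [measurable]: "f \<in> borel_measurable M"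
  shows "weak_Lp_norm M p f \<le> Lp_norm M p f"
proof (cases "(\<integral>\<^sup>+ x. ennreal (\<bar>f x\<bar> powr p) \<partial>M)")
  case (real I)
  show ?thesis
    unfolding weak_Lp_norm_def
  proof (rule SUP_least)
    fix s :: real
    assume s: "s \<in> {0<..<1}"
    define t where "t = (I / s) powr (1 / p)"
    have tp: "t powr p = I / s"
      using p s real(1) by (simp add: t_def powr_powr)
    have "emeasure M {x \<in> space M. \<bar>f x\<bar> > t} \<le> ennreal s"
    proof (cases "I = 0")
      case True
      then have "AE x in M. ennreal (\<bar>f x\<bar> powr p) = 0"
        using real by (subst nn_integral_0_iff_AE[symmetric]) auto
      then have "AE x in M. \<not> \<bar>f x\<bar> > t"
        by eventually_elim (auto simp: t_def True)
      then have "emeasure M {x \<in> space M. \<bar>f x\<bar> > t} = 0"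
        by (subst AE_iff_measurable[symmetric, where P = "\<lambda>x. \<not> \<bar>f x\<bar> > t"]) auto
      then show ?thesis by simp
    next
      case False
      then have I: "0 < I" using real by simp
      have "emeasure M {x \<in> space M. \<bar>f x\<bar> > t}
          \<le> emeasure M {x \<in> space M. 1 \<le> ennreal (s / I) * ennreal (\<bar>f x\<bar> powr p)}"
      proof (rule emeasure_mono; safe?)
        fix x
        assume "\<bar>f x\<bar> > t"
        then have "t powr p \<le> \<bar>f x\<bar> powr p"
          using p by (intro powr_mono2) (auto simp: t_def)
        then have "1 \<le> s / I * \<bar>f x\<bar> powr p"
          using I s by (simp add: tp field_simps)
        then show "1 \<le> ennreal (s / I) * ennreal (\<bar>f x\<bar> powr p)"
          using I s by (simp flip: ennreal_mult)
      qed simp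
      also have "\<dots> \<le> ennreal (s / I) * (\<integral>\<^sup>+ x. ennreal (\<bar>f x\<bar> powr p) * indicator (space M) x \<partial>M)"
        by (rule nn_integral_Markov_inequality) auto
      also have "(\<integral>\<^sup>+ x. ennreal (\<bar>f x\<bar> powr p) * indicator (space M) x \<partial>M) = ennreal I"
        unfolding real(2)[symmetric] by (intro nn_integral_cong) simp
      finally show ?thesis
        using I s by (simp flip: ennreal_mult)
    qed
    then have "decr_rearr M f s \<le> ennreal t"
      unfolding decr_rearr_def by (intro Inf_lower) (auto simp: t_def)
    then have "ennreal (s powr (1 / p)) * decr_rearr M f s \<le> ennreal (s powr (1 / p)) * ennreal t"
      by (rule mult_left_mono) simp
    also have "\<dots> = Lp_norm M p f"
      using s real p by (simp add: t_def Lp_norm_def epowr_ennreal powr_divide flip: ennreal_mult)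
    finally show "ennreal (s powr (1 / p)) * decr_rearr M f s \<le> Lp_norm M p f" .
  qed
next
  case top
  then show ?thesis
    using p by (simp add: Lp_norm_def)
qed

lemma decr_rearr_zero: "0 \<le> s \<Longrightarrow> decr_rearr M (\<lambda>x. 0) s = 0"
  unfolding decr_rearr_def by (rule antisym[OF Inf_lower]) (auto intro!: exI[of _ 0])

lemma weak_Lp_norm_zero: "weak_Lp_norm M p (\<lambda>x. 0) = 0"
  by (simp add: weak_Lp_norm_def decr_rearr_zero)

lemma small_Lp_norm_zero:
  assumes "0 < p"
  shows "small_Lp_norm M p (\<lambda>x. 0) = 0"
proof -
  have "(\<integral>\<^sup>+ \<sigma>\<in>{0<..<t}. epowr (decr_rearr M (\<lambda>x. 0) \<sigma>) p \<partial>lborel)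
      = (\<integral>\<^sup>+ \<sigma>. 0 \<partial>(lborel :: real measure))" for t :: real
    using assms by (intro nn_integral_cong) (auto simp: decr_rearr_zero indicator_def)
  then show ?thesis
    using assms by (simp add: small_Lp_norm_def)
qed

lemma K_functional_le_trivial:
  assumes "f \<in> fun_space M N0" "f \<in> fun_space M N1"
    and "N0 (\<lambda>x. 0) = 0" "N1 (\<lambda>x. 0) = 0"
  shows "K_functional M N0 N1 f t \<le> N0 f" "K_functional M N0 N1 f t \<le> ennreal t * N1 f"
proof -
  have "(\<lambda>x. 0) \<in> fun_space M N0" "(\<lambda>x. 0) \<in> fun_space M N1"
    using assms by (auto simp: fun_space_def)
  then have "K_functional M N0 N1 f t \<le> N0 f + ennreal t * N1 (\<lambda>x. 0)"
    "K_functional M N0 N1 f t \<le> N0 (\<lambda>x. 0) + ennreal t * N1 f"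
    unfolding K_functional_def
    using assms
    by (intro Inf_lower CollectI exI[of _ f] exI[of _ "\<lambda>x. 0"] conjI; simp)+
  then show "K_functional M N0 N1 f t \<le> N0 f" "K_functional M N0 N1 f t \<le> ennreal t * N1 f"
    using assms by auto
qed

text \<open>
  The two bounds for \<open>K\<close> agree at \<open>t = A/B\<close>. Using \<open>t B\<close> before and \<open>A\<close> after this point,
  both power integrals converge, because \<open>\<alpha> < 1\<close> and \<open>\<alpha> > 0\<close> respectively; the second is
  extended to infinity, so that it does not matter whether \<open>A/B\<close> lies in \<open>(0, 1)\<close>.
\<close>
lemma nn_integral_min_powr_le:
  assumes \<alpha>: "0 < \<alpha>" "\<alpha> < 1" and A: "0 < A" and B: "0 < B"
    and K0: "\<And>t. 0 < t \<Longrightarrow> K t \<le> ennreal A" and K1: "\<And>t. 0 < t \<Longrightarrow> K t \<le> ennreal (t * B)"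
  shows "(\<integral>\<^sup>+ t\<in>{0<..<1}. ennreal (t powr (- \<alpha>) / t) * K t \<partial>lborel)
    \<le> ennreal ((1 / (1 - \<alpha>) + 1 / \<alpha>) * (A powr (1 - \<alpha>) * B powr \<alpha>))"
proof -
  let ?r = "A / B"
  have r: "0 < ?r" using A B by simp
  have I0: "(\<integral>\<^sup>+ t\<in>{0..?r}. ennreal (t powr (- \<alpha>)) \<partial>lborel) = ennreal (?r powr (1 - \<alpha>) / (1 - \<alpha>))"
    using has_integral_powr_from_0[of "- \<alpha>" ?r] \<alpha> r
    by (intro nn_integral_has_integral_lebesgue') auto
  have I1: "(\<integral>\<^sup>+ t\<in>{?r..}. ennreal (t powr (- \<alpha> - 1)) \<partial>lborel) = ennreal (?r powr (- \<alpha>) / \<alpha>)"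
    using has_integral_powr_to_inf[of "- \<alpha> - 1" ?r] \<alpha> r
    by (intro nn_integral_has_integral_lebesgue') auto
  have "(\<integral>\<^sup>+ t\<in>{0<..<1}. ennreal (t powr (- \<alpha>) / t) * K t \<partial>lborel)
      \<le> (\<integral>\<^sup>+ t. ennreal B * (ennreal (t powr (- \<alpha>)) * indicator {0..?r} t)
            + ennreal A * (ennreal (t powr (- \<alpha> - 1)) * indicator {?r..} t) \<partial>lborel)"
  proof (rule nn_integral_mono)
    fix t :: real
    show "ennreal (t powr (- \<alpha>) / t) * K t * indicator {0<..<1} t
      \<le> ennreal B * (ennreal (t powr (- \<alpha>)) * indicator {0..?r} t)
          + ennreal A * (ennreal (t powr (- \<alpha> - 1)) * indicator {?r..} t)"
    proof (cases "t \<in> {0<..<1}")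
      case t: True
      show ?thesis
      proof (cases "t \<le> ?r")
        case True
        have "ennreal (t powr (- \<alpha>) / t) * K t \<le> ennreal (t powr (- \<alpha>) / t) * ennreal (t * B)"
          using t by (intro mult_left_mono K1) auto
        also have "\<dots> = ennreal B * ennreal (t powr (- \<alpha>))"
          using t B by (simp add: mult_ac flip: ennreal_mult)
        finally show ?thesis
          using t True by (simp add: add_increasing2)
      next
        case False
        have "ennreal (t powr (- \<alpha>) / t) * K t \<le> ennreal (t powr (- \<alpha>) / t) * ennreal A"
          using t by (intro mult_left_mono K0) auto
        also have "\<dots> = ennreal A * ennreal (t powr (- \<alpha> - 1))"
          using t A by (simp add: mult_ac powr_diff)
        finally show ?thesis
          using t False by simp
      qed
    qed simp
  qed
  also have "\<dots> = ennreal B * ennreal (?r powr (1 - \<alpha>) / (1 - \<alpha>)) + ennreal A * ennreal (?r powr (- \<alpha>) / \<alpha>)"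
    by (subst nn_integral_add; simp?) (simp add: nn_integral_cmult I0 I1)
  also have "\<dots> = ennreal (B * (?r powr (1 - \<alpha>) / (1 - \<alpha>)) + A * (?r powr (- \<alpha>) / \<alpha>))"
    using A B \<alpha> by (simp flip: ennreal_mult ennreal_plus)
  also have "B * (?r powr (1 - \<alpha>) / (1 - \<alpha>)) + A * (?r powr (- \<alpha>) / \<alpha>)
      = (1 / (1 - \<alpha>) + 1 / \<alpha>) * (A powr (1 - \<alpha>) * B powr \<alpha>)"
  proof -
    have "B * ?r powr (1 - \<alpha>) = A powr (1 - \<alpha>) * B powr \<alpha>" "A * ?r powr (- \<alpha>) = A powr (1 - \<alpha>) * B powr \<alpha>"
      using A B by (simp_all add: powr_divide powr_diff powr_minus field_simps)
    then show ?thesis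
      by (simp add: distrib_right)
  qed
  finally show ?thesis .
qed

text \<open>
  If \<open>P\<close> or \<open>N1 f\<close> is 0, the cut \<open>P / N1 f\<close> is meaningless, but then one of the trivial
  decompositions already makes the \<open>K\<close>-functional vanish. If \<open>P\<close> is infinite and
  \<open>N1 f\<close> is not 0, the right-hand side is infinite.
\<close>
lemma interp_norm_le_of_embedding:
  assumes \<alpha>: "0 < \<alpha>" "\<alpha> < 1"
    and f: "f \<in> fun_space M N0" "f \<in> fun_space M N1"
    and zero: "N0 (\<lambda>x. 0) = 0" "N1 (\<lambda>x. 0) = 0"
    and P: "N0 f \<le> P"
  shows "interp_norm M N0 N1 \<alpha> f
    \<le> ennreal (1 / (1 - \<alpha>) + 1 / \<alpha>) * epowr P (1 - \<alpha>) * epowr (N1 f) \<alpha>"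
proof (cases "P = 0 \<or> N1 f = 0")
  case True
  then have "K_functional M N0 N1 f t = 0" for t
    using K_functional_le_trivial[OF f zero, of t] P by auto
  then show ?thesis
    by (simp add: interp_norm_def)
next
  case nz: False
  obtain B where B: "N1 f = ennreal B" "0 < B"
    using f(2) nz by (cases "N1 f") (auto simp: fun_space_def)
  have c: "0 < 1 / (1 - \<alpha>) + 1 / \<alpha>"
    using \<alpha> by (simp add: add_pos_pos)
  show ?thesis
  proof (cases P)
    case (real A)
    then have A: "0 < A" using nz by auto
    have "interp_norm M N0 N1 \<alpha> f \<le> ennreal ((1 / (1 - \<alpha>) + 1 / \<alpha>) * (A powr (1 - \<alpha>) * B powr \<alpha>))"
      unfolding interp_norm_def
    proof (rule nn_integral_min_powr_le[OF \<alpha> A B(2)])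
      fix t :: real
      assume "0 < t"
      show "K_functional M N0 N1 f t \<le> ennreal A"
        using K_functional_le_trivial(1)[OF f zero, of t] P real by auto
      show "K_functional M N0 N1 f t \<le> ennreal (t * B)"
        using K_functional_le_trivial(2)[OF f zero, of t] B \<open>0 < t\<close> by (simp add: ennreal_mult)
    qed
    then show ?thesis
      using c A B \<alpha> by (simp add: real epowr_ennreal ennreal_mult mult.assoc)
  next
    case top
    have "epowr P (1 - \<alpha>) = top" "epowr (N1 f) \<alpha> \<noteq> 0"
      using top \<alpha> nz by simp_all
    then show ?thesis
      using c by (simp add: ennreal_mult_top ennreal_top_mult ennreal_eq_0_iff)
  qed
qed

section \<open>Bounds for the weak norm and the interpolation norm\<close>

theorem mainTheorem8:
  fixes \<Omega> :: "(real ^ 'n) set" and M :: "(real ^ 'n) measure" and n' :: real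
  assumes "CARD('n) \<ge> 2"
    and "bounded \<Omega>" and "open \<Omega>" and "emeasure lebesgue \<Omega> = 1"
    and M: "M = lebesgue_on \<Omega>"
    and n': "n' = conj_exponent CARD('n)"
  shows "(\<forall>\<alpha>::real. 1 / n' < \<alpha> \<and> \<alpha> \<le> 1 \<longrightarrow>
           (\<exists>c::real. c > 0 \<and> (\<forall>v \<in> fun_space M (small_Lp_norm M n').
              weak_Lp_norm M n' v
                \<le> ennreal c * epowr (grand_Lp_norm M n' v) (1 - \<alpha>) * epowr (small_Lp_norm M n' v) \<alpha>)))
       \<and> (\<forall>\<alpha>::real. 0 < \<alpha> \<and> \<alpha> < 1 \<longrightarrow>
           (\<exists>c::real. c > 0 \<and> (\<forall>v \<in> fun_space M (small_Lp_norm M n').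
              interp_norm M (weak_Lp_norm M n') (small_Lp_norm M n') \<alpha> v
                \<le> ennreal c * epowr (Lp_norm M n' v) (1 - \<alpha>) * epowr (small_Lp_norm M n' v) \<alpha>)))"
proof (intro conjI allI impI)
  have p: "1 \<le> n'"
    using assms(1) by (simp add: n' conj_exponent_def field_simps)
  show "\<exists>c::real. c > 0 \<and> (\<forall>v \<in> fun_space M (small_Lp_norm M n').
      weak_Lp_norm M n' v
        \<le> ennreal c * epowr (grand_Lp_norm M n' v) (1 - \<alpha>) * epowr (small_Lp_norm M n' v) \<alpha>)"
    if "1 / n' < \<alpha> \<and> \<alpha> \<le> 1" for \<alpha>
    using that p
    by (intro exI[of _ "(2 * exp 1) powr (1 / n')"] conjI ballI weak_Lp_norm_le_grand_small) auto
  show "\<exists>c::real. c > 0 \<and> (\<forall>v \<in> fun_space M (small_Lp_norm M n').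
      interp_norm M (weak_Lp_norm M n') (small_Lp_norm M n') \<alpha> v
        \<le> ennreal c * epowr (Lp_norm M n' v) (1 - \<alpha>) * epowr (small_Lp_norm M n' v) \<alpha>)"
    if \<alpha>: "0 < \<alpha> \<and> \<alpha> < 1" for \<alpha>
  proof (intro exI[of _ "1 / (1 - \<alpha>) + 1 / \<alpha>"] conjI ballI)
    fix v
    assume v: "v \<in> fun_space M (small_Lp_norm M n')"
    have "v \<in> fun_space M (weak_Lp_norm M n')"
      using v weak_Lp_norm_le_small[OF p, of M v]
      by (auto simp: fun_space_def ennreal_mult_less_top intro: le_less_trans)
    then show "interp_norm M (weak_Lp_norm M n') (small_Lp_norm M n') \<alpha> v
        \<le> ennreal (1 / (1 - \<alpha>) + 1 / \<alpha>) * epowr (Lp_norm M n' v) (1 - \<alpha>)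
            * epowr (small_Lp_norm M n' v) \<alpha>"
      using \<alpha> p v
      by (intro interp_norm_le_of_embedding weak_Lp_norm_le_Lp_norm weak_Lp_norm_zero small_Lp_norm_zero)
        (auto simp: fun_space_def)
  qed (use \<alpha> in \<open>simp add: add_pos_pos\<close>)
qed

end
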